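(* The Erdős set $E\subset[0,1)$, viewed as a subset of $\mathbb{R}/\mathbb{Z}$, is an Erdős semi-group (ESG) in $\mathbb{R}/\mathbb{Z}$.
   Context: $\mathbb{N}=\{1,2,3,\dots\}$, and $\mathbb{R}/\mathbb{Z}$ is identified with $[0,1)$ in the natural way. Each $x\in[0,1)$ is identified with its binary expansion $x_1x_2\dots\in\{0,1\}^{\mathbb{N}}$, $x=\sum_{i\ge1}2^{-i}x_i$; if $x$ is a dyadic rational, the expansion with only finitely many digits $1$ is always used. The set of positions of digit $1$ of $x$ is $A_x=\{n\in\mathbb{N}:x_n=1\}$. Erdős set: $x\in[0,1)$ is called Erdősian if $A_x$ does not contain arbitrarily long arithmetic progressions (i.e. there is $k\in\mathbb{N}$ such that $A_x$ contains no $k$-term arithmetic progression with nonzero common difference). The Erdős set $E$ is the set of all Erdősian numbers in $[0,1)$. $\times 2 \bmod 1$ invariance: a set $F\subset[0,1)$ is $\times2\bmod1$ invariant if $T(F)\subset F$, where $T(x)=2x\bmod 1$. Subsequence in terms of binary expansion: $y\in[0,1)$ is a subsequence of $x\in[0,1)$ in terms of binary expansion if there is an integer $N>0$ such that for all $i\in\mathbb{N}$, $y_{i+N}=1$ implies $x_i=1$, and $y_j=0$ for all $j\le N$. ESG: a set $G\subset\mathbb{R}/\mathbb{Z}$ is a (binary) Erdős semi-group (ESG) if: (1) $G=\bigcup_{i\in\mathbb{N}}F_i$ where each $F_i$ is a closed $\times2\bmod1$ invariant subset of $\mathbb{R}/\mathbb{Z}$; (2) there is a function $W:\mathbb{N}^2\to\mathbb{N}$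 such that for all $i,j\in\mathbb{N}$, $F_i+F_j\subset F_{W(i,j)}$ (addition in $\mathbb{R}/\mathbb{Z}$); (3) for all $i\in\mathbb{N}$, if $x\in F_i$ then $y\in F_i$ for every subsequence $y$ of $x$ in terms of binary expansion. *)

theory Defs
  imports "HOL-Analysis.Analysis"
begin

section \<open>The circle \<open>\<real>/\<int>\<close> on the fundamental domain \<open>[0,1)\<close>\<close>

text \<open>
  A point of \<open>\<real>/\<int>\<close> is represented by its representative in \<open>{0..<1}\<close>, so that
  the canonical projection \<open>\<real> \<rightarrow> \<real>/\<int>\<close> becomes \<^const>\<open>frac\<close>. The topology is the quotient
  topology along this projection; it is not the subspace topology of \<open>{0..<1}\<close> in the reals.
\<close>

definition circle_top :: "real topology" where
  "circle_top = topology (\<lambda>U. U \<subseteq> {0..<1} \<and> open (frac -` U))"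

lemma openin_circle_top: "openin circle_top U \<longleftrightarrow> U \<subseteq> {0..<1} \<and> open (frac -` U)"
proof -
  have "istopology (\<lambda>U. U \<subseteq> {0..<1::real} \<and> open (frac -` U :: real set))"
    unfolding istopology_def by (auto simp: vimage_Int vimage_Union)
  then show ?thesis
    by (simp add: circle_top_def topology_inverse')
qed

lemma topspace_circle_top [simp]: "topspace circle_top = {0..<1}"
proof -
  have "frac -` {0..<1} = (UNIV :: real set)"
    by (auto simp: frac_lt_1)
  then have "openin circle_top {0..<1}"
    by (simp add: openin_circle_top)
  then show ?thesis
    by (metis openin_circle_top openin_subset openin_topspace subset_antisym)
qed

lemma quotient_map_frac: "quotient_map euclideanreal circle_top frac"
proof -
  have "x \<in> range frac" if "0 \<le> x" "x < 1" for x :: real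
    using that by (metis frac_eq rangeI)
  then have "range frac = {0..<1::real}"
    by (auto simp: frac_lt_1)
  then show ?thesis
    by (simp add: quotient_map_def openin_circle_top vimage_def)
qed

definition circle_sumset :: "real set \<Rightarrow> real set \<Rightarrow> real set" where
  "circle_sumset A B = {frac (x + y) | x y. x \<in> A \<and> y \<in> B}"

definition times2 :: "real \<Rightarrow> real" where
  "times2 x = frac (2 * x)"

definition times2_invariant :: "real set \<Rightarrow> bool" where
  "times2_invariant F \<longleftrightarrow> F \<subseteq> {0..<1} \<and> times2 ` F \<subseteq> F"


section \<open>Binary expansions\<close>

definition dyadic_rational :: "real \<Rightarrow> bool" where
  "dyadic_rational x \<longleftrightarrow> (\<exists>(m::int) (n::nat). x = of_int m / 2 ^ n)"

text \<open>
  Digits are indexed by \<open>1, 2, 3, \<dots>\<close>; the unused value \<open>d 0\<close> is set to \<open>0\<close> to make the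
  expansion unique as a function on the type \<^typ>\<open>nat\<close>.
\<close>

definition is_binary_expansion :: "real \<Rightarrow> (nat \<Rightarrow> nat) \<Rightarrow> bool" where
  "is_binary_expansion x d \<longleftrightarrow>
     d 0 = 0 \<and> range d \<subseteq> {0, 1} \<and>
     (\<lambda>i. real (d (Suc i)) / 2 ^ Suc i) sums x \<and>
     (dyadic_rational x \<longrightarrow> finite {n. d n = 1})"

definition binary_digit :: "real \<Rightarrow> nat \<Rightarrow> nat" where
  "binary_digit x = (THE d. is_binary_expansion x d)"

definition one_positions :: "real \<Rightarrow> nat set" where
  "one_positions x = {n. 1 \<le> n \<and> binary_digit x n = 1}"

text \<open>
  The description in \<^const>\<open>binary_digit\<close> is proper: on \<open>{0..<1}\<close> the expansion exists, is
  unique and is given by the usual floor formula.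
\<close>

lemma is_binary_expansion_floor:
  fixes x :: real
  assumes x: "0 \<le> x" "x < 1"
  shows "is_binary_expansion x (\<lambda>n. nat (\<lfloor>2 ^ n * x\<rfloor> mod 2))"
proof -
  define d where "d = (\<lambda>n. nat (\<lfloor>2 ^ n * x\<rfloor> mod 2))"
  have fl0: "\<lfloor>x\<rfloor> = 0"
    using x by linarith
  have step: "\<lfloor>2 ^ Suc n * x\<rfloor> = 2 * \<lfloor>2 ^ n * x\<rfloor> + int (d (Suc n))" for n
  proof -
    have "\<lfloor>2 ^ Suc n * x\<rfloor> div 2 = \<lfloor>2 ^ n * x\<rfloor>"
      using floor_divide_real_eq_div[of 2 "2 ^ Suc n * x"] by simp
    then show ?thesis
      by (simp add: d_def) presburger
  qed
  have psum: "(\<Sum>i<n. real (d (Suc i)) / 2 ^ Suc i) = of_int \<lfloor>2 ^ n * x\<rfloor> / 2 ^ n" for n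
  proof (induction n)
    case 0
    then show ?case by (simp add: fl0)
  next
    case (Suc n)
    show ?case
      unfolding sum.lessThan_Suc Suc.IH step by (simp add: field_simps)
  qed
  have "(\<lambda>n. of_int \<lfloor>2 ^ n * x\<rfloor> / 2 ^ n) \<longlonglongrightarrow> x"
  proof (rule tendsto_sandwich)
    show "\<forall>\<^sub>F n in sequentially. x - (1 / 2) ^ n \<le> of_int \<lfloor>2 ^ n * x\<rfloor> / 2 ^ n"
    proof (rule always_eventually, rule allI)
      fix n
      have "2 ^ n * x - 1 \<le> of_int \<lfloor>2 ^ n * x\<rfloor>"
        by linarith
      then have "(2 ^ n * x - 1) / 2 ^ n \<le> of_int \<lfloor>2 ^ n * x\<rfloor> / 2 ^ n"
        by (rule divide_right_mono) simp
      then show "x - (1 / 2) ^ n \<le> of_int \<lfloor>2 ^ n * x\<rfloor> / 2 ^ n"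
        by (simp add: diff_divide_distrib power_one_over)
    qed
    show "\<forall>\<^sub>F n in sequentially. of_int \<lfloor>2 ^ n * x\<rfloor> / 2 ^ n \<le> x"
    proof (rule always_eventually, rule allI)
      fix n
      have "of_int \<lfloor>2 ^ n * x\<rfloor> \<le> 2 ^ n * x"
        by linarith
      then show "of_int \<lfloor>2 ^ n * x\<rfloor> / 2 ^ n \<le> x"
        by (simp add: field_simps)
    qed
    have "(\<lambda>n. x - (1 / 2) ^ n) \<longlonglongrightarrow> x - 0"
      by (intro tendsto_intros LIMSEQ_power_zero) simp
    then show "(\<lambda>n. x - (1 / 2) ^ n) \<longlonglongrightarrow> x" by simp
  qed simp
  then have sums: "(\<lambda>i. real (d (Suc i)) / 2 ^ Suc i) sums x"
    unfolding sums_def psum .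
  have "finite {n. d n = 1}" if dy: "dyadic_rational x"
  proof -
    obtain m :: int and N :: nat where xe: "x = of_int m / 2 ^ N"
      using dy unfolding dyadic_rational_def by blast
    have "d n = 0" if "N < n" for n
    proof -
      have n: "n = Suc (N + (n - Suc N))"
        using that by simp
      have "2 ^ n * x = of_int (2 * (2 ^ (n - Suc N) * m))"
        by (subst n) (simp add: xe power_add)
      then have "\<lfloor>2 ^ n * x\<rfloor> = 2 * (2 ^ (n - Suc N) * m)"
        by (simp only: floor_of_int)
      then show ?thesis
        by (simp add: d_def)
    qed
    then have "{n. d n = 1} \<subseteq> {..N}"
      by (metis (mono_tags, lifting) atMost_iff mem_Collect_eq not_le subsetI zero_neq_one)
    then show ?thesis
      by (rule finite_subset) simp
  qed
  moreover have "d 0 = 0"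
    by (simp add: d_def fl0)
  moreover have "d n \<in> {0, 1}" for n
    unfolding d_def by (cases "even \<lfloor>2 ^ n * x\<rfloor>") (auto simp: odd_iff_mod_2_eq_one)
  ultimately show ?thesis
    using sums unfolding is_binary_expansion_def d_def[symmetric]
    by (intro conjI image_subsetI impI)
qed

lemma is_binary_expansion_unique:
  fixes x :: real
  assumes d: "is_binary_expansion x d"
  shows "d = (\<lambda>n. nat (\<lfloor>2 ^ n * x\<rfloor> mod 2))"
proof -
  define f where "f = (\<lambda>i. real (d (Suc i)) / 2 ^ Suc i)"
  have d0: "d 0 = 0" and d01: "\<And>n. d n = 0 \<or> d n = 1" and sums: "f sums x"
    and fin: "dyadic_rational x \<Longrightarrow> finite {n. d n = 1}"
    using d unfolding is_binary_expansion_def f_def by auto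
  define p where "p = (\<lambda>n. \<Sum>i<n. 2 ^ (n - Suc i) * int (d (Suc i)))"
  have p_Suc: "p (Suc n) = 2 * p n + int (d (Suc n))" for n
  proof -
    have "(\<Sum>i<n. 2 ^ (Suc n - Suc i) * int (d (Suc i)))
        = (\<Sum>i<n. 2 * (2 ^ (n - Suc i) * int (d (Suc i))))"
    proof (rule sum.cong, simp)
      fix i assume "i \<in> {..<n}"
      then have "Suc n - Suc i = Suc (n - Suc i)" by auto
      then show "2 ^ (Suc n - Suc i) * int (d (Suc i)) = 2 * (2 ^ (n - Suc i) * int (d (Suc i)))"
        by simp
    qed
    then show ?thesis
      by (simp add: p_def sum_distrib_left)
  qed
  have psum: "(\<Sum>i<n. f i) = of_int (p n) / 2 ^ n" for n
  proof (induction n)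
    case 0
    then show ?case by (simp add: p_def)
  next
    case (Suc n)
    show ?case
      unfolding sum.lessThan_Suc Suc.IH p_Suc by (simp add: f_def field_simps)
  qed
  have fl: "\<lfloor>2 ^ n * x\<rfloor> = p n" for n
  proof -
    define g where "g = (\<lambda>i. (1 / 2 :: real) ^ Suc (i + n))"
    have "(\<lambda>i. (1 / 2) ^ n * ((1 / 2 :: real) * (1 / 2) ^ i)) sums ((1 / 2) ^ n * (1 / 2 * 2))"
      using geometric_sums[of "1 / 2 :: real"] by (intro sums_mult) simp
    then have g: "g sums ((1 / 2) ^ n)"
      by (simp add: g_def power_add mult_ac)
    have t: "(\<lambda>i. f (i + n)) sums (x - of_int (p n) / 2 ^ n)"
      using sums_split_initial_segment[OF sums, of n] by (simp add: psum)
    have "0 \<le> x - of_int (p n) / 2 ^ n"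
      using sums_le[OF _ sums_zero t] by (simp add: f_def)
    moreover have le: "f (i + n) \<le> g i" for i
      using d01[of "Suc (i + n)"] by (auto simp: f_def g_def power_one_over field_simps)
    then have "x - of_int (p n) / 2 ^ n \<le> (1 / 2) ^ n"
      using sums_le[OF _ t g] by blast
    moreover have "x - of_int (p n) / 2 ^ n \<noteq> (1 / 2) ^ n"
    proof
      assume eq: "x - of_int (p n) / 2 ^ n = (1 / 2) ^ n"
      then have "x = of_int (p n + 1) / 2 ^ n"
        by (simp add: field_simps power_one_over)
      then have "dyadic_rational x"
        unfolding dyadic_rational_def by blast
      then have "finite {n. d n = 1}"
        by (rule fin)
      moreover have "(\<lambda>i. g i - f (i + n)) sums 0"
        using sums_diff[OF g t] eq by simp
      then have z: "g i - f (i + n) = 0" for i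
        using le suminf_eq_zero_iff[of "\<lambda>i. g i - f (i + n)"]
        by (auto simp: sums_iff)
      have "d (Suc (i + n)) = 1" for i
        using z[of i] d01[of "Suc (i + n)"] by (auto simp: f_def g_def)
      then have "range (\<lambda>i. Suc (i + n)) \<subseteq> {n. d n = 1}"
        by auto
      moreover have "infinite (range (\<lambda>i. Suc (i + n)))"
        by (rule range_inj_infinite) (auto intro: injI)
      ultimately show False
        using finite_subset by blast
    qed
    ultimately have "0 \<le> x - of_int (p n) / 2 ^ n" "x - of_int (p n) / 2 ^ n < (1 / 2) ^ n"
      by auto
    then have "of_int (p n) / 2 ^ n \<le> x" "x < (of_int (p n) + 1) / 2 ^ n"
      by (auto simp: add_divide_distrib power_one_over)
    then have "of_int (p n) \<le> 2 ^ n * x" "2 ^ n * x < of_int (p n) + 1"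
      by (auto simp: field_simps)
    then show ?thesis
      by linarith
  qed
  show ?thesis
  proof
    fix n
    show "d n = nat (\<lfloor>2 ^ n * x\<rfloor> mod 2)"
    proof (cases n)
      case 0
      then show ?thesis
        using fl[of 0] d0 by (simp add: p_def)
    next
      case (Suc m)
      then show ?thesis
        using d01[of n] unfolding fl by (auto simp: p_Suc)
    qed
  qed
qed

lemma binary_digit_floor:
  assumes "0 \<le> x" "x < 1"
  shows "binary_digit x n = nat (\<lfloor>2 ^ n * x\<rfloor> mod 2)"
  using the_equality[of "is_binary_expansion x", OF is_binary_expansion_floor[OF assms]]
    is_binary_expansion_unique
  unfolding binary_digit_def by metis

lemma is_binary_expansion_binary_digit:
  assumes "0 \<le> x" "x < 1"
  shows "is_binary_expansion x (binary_digit x)"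
  using is_binary_expansion_floor[OF assms] binary_digit_floor[OF assms] by presburger

definition binary_subsequence :: "real \<Rightarrow> real \<Rightarrow> bool" where
  "binary_subsequence y x \<longleftrightarrow>
     (\<exists>N>0. (\<forall>i\<ge>1. binary_digit y (i + N) = 1 \<longrightarrow> binary_digit x i = 1) \<and>
            (\<forall>j. 1 \<le> j \<and> j \<le> N \<longrightarrow> binary_digit y j = 0))"


section \<open>Erdos set and Erdos semi-groups\<close>

text \<open>
  Progressions are listed in increasing order, so the nonzero common difference may be
  taken positive.
\<close>

definition contains_AP :: "nat set \<Rightarrow> nat \<Rightarrow> bool" where
  "contains_AP A k \<longleftrightarrow> (\<exists>a d. d > 0 \<and> (\<forall>j<k. a + j * d \<in> A))"

definition erdosian :: "real \<Rightarrow> bool" where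
  "erdosian x \<longleftrightarrow> (\<exists>k\<ge>1. \<not> contains_AP (one_positions x) k)"

definition erdos_set :: "real set" where
  "erdos_set = {x \<in> {0..<1}. erdosian x}"

text \<open>
  The index set of the positive integers is rendered as \<^typ>\<open>nat\<close> guarded by \<open>\<ge> 1\<close>.
\<close>

definition erdos_semigroup :: "real set \<Rightarrow> bool" where
  "erdos_semigroup G \<longleftrightarrow>
     (\<exists>F :: nat \<Rightarrow> real set.
        G = (\<Union>i\<in>{1..}. F i) \<and>
        (\<forall>i\<ge>1. closedin circle_top (F i) \<and> times2_invariant (F i)) \<and>
        (\<exists>W :: nat \<Rightarrow> nat \<Rightarrow> nat. \<forall>i\<ge>1. \<forall>j\<ge>1.
           W i j \<ge> 1 \<and> circle_sumset (F i) (F j) \<subseteq> F (W i j)) \<and>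
        (\<forall>i\<ge>1. \<forall>x\<in>F i. \<forall>y\<in>{0..<1}. binary_subsequence y x \<longrightarrow> y \<in> F i))"

end

theory Submission
  imports Defs
begin

text \<open>
  Let \<open>F k\<close> consist of the points whose set of positions of \<open>1\<close> has no \<open>k\<close>-term progression.
  A position of digit \<open>1\<close> in \<open>x + y\<close> is, up to a shift by \<open>1\<close> that accounts for the carry, a
  position of digit \<open>1\<close> in \<open>x\<close> or in \<open>y\<close>; so van der Waerden's theorem for four colours, which
  is proved by colour focusing, gives the semigroup law. The set \<open>F k\<close> is closed because the
  digits of \<open>x\<close> are locally constant except to the left of a dyadic rational, and points just to
  the left of a dyadic rational have long blocks of consecutive digits \<open>1\<close>.
\<close>

section \<open>Van der Waerden's theorem\<close>

text \<open>
  Colourings are total on the naturals, and the bound includes the term \<open>a + k * d\<close> following the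
  progression, which serves as the focus in the induction.
\<close>

definition vdw_bound :: "nat \<Rightarrow> nat \<Rightarrow> nat \<Rightarrow> bool" where
  "vdw_bound k r N \<longleftrightarrow> (\<forall>c :: nat \<Rightarrow> nat. range c \<subseteq> {..<r} \<longrightarrow>
     (\<exists>a d. d > 0 \<and> a + k * d \<le> N \<and> (\<forall>j<k. c (a + j * d) = c a)))"

text \<open>Blocks will be coloured by functions, so the bound is transported along a bijection from
  \<open>S\<close> to an initial segment of the naturals.\<close>

lemma vdw_bound_finite_colours:
  fixes c :: "nat \<Rightarrow> 'b"
  assumes "vdw_bound k (card S) N" "finite S" "range c \<subseteq> S"
  obtains a d where "d > 0" "a + k * d \<le> N" "\<And>j. j < k \<Longrightarrow> c (a + j * d) = c a"
proof -
  obtain h where h: "bij_betw h S {0..<card S}"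
    using ex_bij_betw_finite_nat[OF assms(2)] by blast
  have "range (h \<circ> c) \<subseteq> {..<card S}"
    using assms(3) bij_betwE[OF h] by fastforce
  then obtain a d where "d > 0" "a + k * d \<le> N" and eq: "\<forall>j<k. h (c (a + j * d)) = h (c a)"
    using assms(1) unfolding vdw_bound_def comp_apply by blast
  moreover have "c (a + j * d) = c a" if "j < k" for j
    using inj_onD[OF bij_betw_imp_inj_on[OF h]] eq that assms(3) by blast
  ultimately show thesis
    using that by blast
qed

section \<open>Colour focusing\<close>

text \<open>\<open>f\<close> is the common focus. Injectivity makes the colours of the
  \<open>s\<close> progressions distinct, so a family of size \<open>r\<close> uses up
  \<open>r\<close> colours.\<close>

definition focused_APs :: "nat \<Rightarrow> (nat \<Rightarrow> 'b) \<Rightarrow> nat \<Rightarrow> nat \<Rightarrow> (nat \<Rightarrow> nat) \<Rightarrow> (nat \<Rightarrow> nat) \<Rightarrow> bool" where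
  "focused_APs k c s f a d \<longleftrightarrow> inj_on (\<lambda>i. c (a i)) {..<s} \<and>
     (\<forall>i<s. d i > 0 \<and> a i + k * d i = f \<and> (\<forall>j<k. c (a i + j * d i) = c (a i)))"

text \<open>Moving the \<open>j\<close>-th term of each progression into the \<open>j\<close>-th
  copy of the pattern adds \<open>D\<close> to its difference, and the copies of the old focus form
  one more progression. All of them then focus at the old focus moved on by \<open>k\<close>
  periods.\<close>

lemma focused_APs_extend:
  assumes foc: "focused_APs k (\<lambda>x. c (b + x)) s f a d"
    and new: "\<And>i. i < s \<Longrightarrow> c (b + a i) \<noteq> c (b + f)"
    and "D > 0" "f < M"
    and per: "\<And>j x. j < k \<Longrightarrow> x < M \<Longrightarrow> c (b + j * D + x) = c (b + x)"
  shows "focused_APs k c (Suc s) (b + f + k * D)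
           (\<lambda>i. if i < s then b + a i else b + f) (\<lambda>i. if i < s then d i + D else D)"
proof -
  have inj: "inj_on (\<lambda>i. c (b + a i)) {..<s}"
    and d: "\<And>i. i < s \<Longrightarrow> d i > 0"
    and foc_eq: "\<And>i. i < s \<Longrightarrow> a i + k * d i = f"
    and mono: "\<And>i j. i < s \<Longrightarrow> j < k \<Longrightarrow> c (b + (a i + j * d i)) = c (b + a i)"
    using foc unfolding focused_APs_def by auto
  have "inj_on (\<lambda>i. c (if i < s then b + a i else b + f)) {..<Suc s}"
    unfolding inj_on_def
  proof (intro ballI impI)
    fix x y
    assume "x \<in> {..<Suc s}" "y \<in> {..<Suc s}"
      "c (if x < s then b + a x else b + f) = c (if y < s then b + a y else b + f)"
    then show "x = y"
      using new[of x] new[of y] inj_onD[OF inj, of x y]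
      by (cases "x < s"; cases "y < s") auto
  qed
  moreover have "c (b + a i + j * (d i + D)) = c (b + a i)" if "i < s" "j < k" for i j
  proof -
    have "j * d i \<le> k * d i"
      using that by simp
    then have "a i + j * d i < M"
      using foc_eq[OF that(1)] \<open>f < M\<close> by linarith
    then show ?thesis
      using per[OF that(2), of "a i + j * d i"] mono[OF that] by (simp add: algebra_simps)
  qed
  moreover have "c (b + f + j * D) = c (b + f)" if "j < k" for j
    using per[OF that \<open>f < M\<close>] by (simp add: algebra_simps)
  moreover have "b + a i + k * (d i + D) = b + f + k * D" if "i < s" for i
    using foc_eq[OF that] by (simp add: algebra_simps)
  ultimately show ?thesis
    unfolding focused_APs_def using d \<open>D > 0\<close> by auto
qed

text \<open>The focus is the next term of every progression in the family, so it prolongs one of its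
  own colour.\<close>

lemma focused_APs_hit:
  assumes "focused_APs k c s f a d" "i < s" "c (a i) = c f"
  shows "d i > 0 \<and> a i + k * d i = f \<and> (\<forall>j<Suc k. c (a i + j * d i) = c (a i))"
proof -
  have "d i > 0" and foc: "a i + k * d i = f" and "\<forall>j<k. c (a i + j * d i) = c (a i)"
    using assms(1,2) unfolding focused_APs_def by blast+
  moreover have "c (a i + k * d i) = c (a i)"
    unfolding foc using assms(3) ..
  ultimately show ?thesis
    by (blast elim: less_SucE)
qed

text \<open>In the induction on \<open>s\<close>, the colour pattern of a block of length
  \<open>M\<close> counts as a single colour. The hypothesis for \<open>k\<close> terms repeats one
  block in progression; the family inside it either is prolonged by its focus or gains a
  member.\<close>

lemma vdw_focusing:
  assumes vdw: "\<And>r. \<exists>N. vdw_bound k r N"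
  shows "\<exists>M. \<forall>c :: nat \<Rightarrow> nat. range c \<subseteq> {..<r} \<longrightarrow>
     (\<exists>a d. d > 0 \<and> a + k * d < M \<and> (\<forall>j<Suc k. c (a + j * d) = c a)) \<or>
     (\<exists>f a d. f < M \<and> focused_APs k c s f a d)"
proof (induction s)
  case 0
  then show ?case
    by (rule exI[of _ 1]) (auto simp: focused_APs_def)
next
  case (Suc s)
  obtain M where M: "\<forall>c :: nat \<Rightarrow> nat. range c \<subseteq> {..<r} \<longrightarrow>
     (\<exists>a d. d > 0 \<and> a + k * d < M \<and> (\<forall>j<Suc k. c (a + j * d) = c a)) \<or>
     (\<exists>f a d. f < M \<and> focused_APs k c s f a d)"
    using Suc.IH by (rule exE)
  define S where "S = ({..<M} \<rightarrow>\<^sub>E {..<r})"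
  have "finite S"
    by (simp add: S_def finite_PiE)
  obtain N where N: "vdw_bound k (card S) N"
    using vdw by blast
  show ?case
  \<comment> \<open>Blocks \<open>0\<close> to \<open>N\<close> suffice: since
    \<open>b + k * D \<le> N\<close>, the block of the new focus is among them.\<close>
  proof (rule exI[of _ "Suc N * M"], intro allI impI)
    fix c :: "nat \<Rightarrow> nat"
    assume c: "range c \<subseteq> {..<r}"
    define blk where "blk n = (\<lambda>x\<in>{..<M}. c (n * M + x))" for n
    have "range blk \<subseteq> S"
      using c by (auto simp: blk_def S_def image_subset_iff split: if_splits)
    then obtain b D where D: "D > 0" and bD: "b + k * D \<le> N"
      and blk_eq: "\<And>j. j < k \<Longrightarrow> blk (b + j * D) = blk b"
      using vdw_bound_finite_colours[OF N \<open>finite S\<close>] by metis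
    have per: "c (b * M + j * (D * M) + x) = c (b * M + x)" if "j < k" "x < M" for j x
    proof -
      have "c ((b + j * D) * M + x) = c (b * M + x)"
        using fun_cong[OF blk_eq[OF that(1)], of x] that(2) by (simp add: blk_def)
      then show ?thesis
        by (simp add: add_mult_distrib mult.assoc)
    qed
    have bound: "b * M + x + k * (D * M) < Suc N * M" if "x < M" for x
      using mult_le_mono1[OF bD, of M] that by (simp add: algebra_simps)
    have bound': "b * M + x < Suc N * M" if "x < M" for x
      using bound[OF that] by linarith
    have "range (\<lambda>x. c (b * M + x)) \<subseteq> {..<r}"
      using c by auto
    from M[rule_format, OF this]
    show "(\<exists>a d. d > 0 \<and> a + k * d < Suc N * M \<and> (\<forall>j<Suc k. c (a + j * d) = c a)) \<or>
       (\<exists>f a d. f < Suc N * M \<and> focused_APs k c (Suc s) f a d)" (is "?AP \<or> ?foc")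
    proof (elim disjE exE conjE)
      fix a d
      assume "d > 0" "a + k * d < M" "\<forall>j<Suc k. c (b * M + (a + j * d)) = c (b * M + a)"
      then have ?AP
        using bound'[of "a + k * d"] by (intro exI[of _ "b * M + a"] exI[of _ d]) (auto simp: add.assoc)
      then show ?thesis ..
    next
      fix f a d
      assume f: "f < M" and foc: "focused_APs k (\<lambda>x. c (b * M + x)) s f a d"
      show ?thesis
      proof (cases "\<exists>i<s. c (b * M + a i) = c (b * M + f)")
        case True
        then obtain i where "i < s" "c (b * M + a i) = c (b * M + f)"
          by blast
        from focused_APs_hit[OF foc this] have ?AP
          using bound'[OF f] by (intro exI[of _ "b * M + a i"] exI[of _ "d i"]) (auto simp: add.assoc)
        then show ?thesis ..
      next
        case False
        have "D * M > 0"
          using D f by simp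
        with focused_APs_extend[OF foc _ _ f per] False bound[OF f]
        have ?foc
          by blast
        then show ?thesis ..
      qed
    qed
  qed
qed

text \<open>With as many focused progressions as colours, every colour occurs among them, so the
  focus shares its colour with one.\<close>

theorem van_der_waerden: "\<exists>N. vdw_bound k r N"
proof (induction k arbitrary: r)
  case 0
  then show ?case
    by (auto simp: vdw_bound_def)
next
  case (Suc k)
  obtain M where M: "\<forall>c :: nat \<Rightarrow> nat. range c \<subseteq> {..<r} \<longrightarrow>
     (\<exists>a d. d > 0 \<and> a + k * d < M \<and> (\<forall>j<Suc k. c (a + j * d) = c a)) \<or>
     (\<exists>f a d. f < M \<and> focused_APs k c r f a d)"
    using vdw_focusing[OF Suc.IH] by (rule exE)
  \<comment> \<open>The second \<open>M\<close> leaves room for the following term, as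
    \<open>d \<le> k * d < M\<close> for \<open>k > 0\<close>; the \<open>+ 1\<close> serves
    \<open>k = 0\<close> with difference \<open>1\<close>.\<close>
  have "vdw_bound (Suc k) r (2 * M + 1)"
    unfolding vdw_bound_def
  proof (intro allI impI)
    fix c :: "nat \<Rightarrow> nat"
    assume c: "range c \<subseteq> {..<r}"
    have AP: "\<exists>a d. d > 0 \<and> a + k * d < M \<and> (\<forall>j<Suc k. c (a + j * d) = c a)"
      using M[rule_format, OF c]
    proof (elim disjE exE conjE)
      fix f a d
      assume f: "f < M" and foc: "focused_APs k c r f a d"
      have "(\<lambda>i. c (a i)) ` {..<r} = {..<r}"
        using foc c by (intro endo_inj_surj) (auto simp: focused_APs_def)
      moreover have "c f \<in> {..<r}"
        using c by blast
      ultimately obtain i where "i < r" "c (a i) = c f"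
        by (metis (no_types, lifting) imageE lessThan_iff)
      from focused_APs_hit[OF foc this] f show ?thesis
        by (metis (no_types, lifting))
    qed blast
    show "\<exists>a d. d > 0 \<and> a + Suc k * d \<le> 2 * M + 1 \<and> (\<forall>j<Suc k. c (a + j * d) = c a)"
    proof (cases "k = 0")
      case True
      then show ?thesis
        by (intro exI[of _ 0] exI[of _ 1]) auto
    next
      case False
      obtain a d where "d > 0" and bound: "a + k * d < M" and "\<forall>j<Suc k. c (a + j * d) = c a"
        using AP by blast
      moreover have "d \<le> k * d"
        using False by simp
      then have "a + Suc k * d \<le> 2 * M + 1"
        using bound unfolding mult_Suc by linarith
      ultimately show ?thesis
        by blast
    qed
  qed
  then show ?case ..
qed

section \<open>Progressions under inclusion, shift and finite union\<close>

lemma contains_AP_mono: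
  assumes "contains_AP A l" "k \<le> l"
  shows "contains_AP A k"
proof -
  have "j < l" if "j < k" for j
    using that assms(2) by simp
  then show ?thesis
    using assms(1) unfolding contains_AP_def by blast
qed

lemma contains_AP_subset:
  assumes "contains_AP A k" "A \<subseteq> B"
  shows "contains_AP B k"
  using assms unfolding contains_AP_def by blast

lemma contains_AP_shift:
  assumes "contains_AP {n. n + m \<in> A} k"
  shows "contains_AP A k"
proof -
  obtain a d where "d > 0" "\<forall>j<k. a + j * d + m \<in> A"
    using assms unfolding contains_AP_def by auto
  then have "\<forall>j<k. (a + m) + j * d \<in> A"
    by (simp add: ac_simps)
  with \<open>d > 0\<close> show ?thesis
    unfolding contains_AP_def by blast
qed

text \<open>The index of each term is coloured by a set containing that term; a monochromatic
  progression of indices gives a progression inside one set.\<close>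

lemma contains_AP_finite_union:
  "\<exists>L\<ge>1. \<forall>S :: nat \<Rightarrow> nat set. contains_AP (\<Union>i<r. S i) L \<longrightarrow> (\<exists>i<r. contains_AP (S i) k)"
proof -
  obtain N where N: "vdw_bound k r N"
    using van_der_waerden by blast
  have "\<exists>i<r. contains_AP (S i) k" if AP: "contains_AP (\<Union>i<r. S i) (Suc N)" for S
  proof -
    obtain a d where d: "d > 0" and mem: "\<And>j. j \<le> N \<Longrightarrow> \<exists>i<r. a + j * d \<in> S i"
      using AP unfolding contains_AP_def UN_iff lessThan_iff less_Suc_eq_le by blast
    \<comment> \<open>\<open>min j N\<close> extends the colouring of the indices up to
      \<open>N\<close> to all naturals, as \<open>vdw_bound\<close> requires.\<close>
    define c where "c j = (SOME i. i < r \<and> a + min j N * d \<in> S i)" for j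
    have c: "c j < r \<and> a + min j N * d \<in> S (c j)" for j
      unfolding c_def by (rule someI_ex) (use mem in simp)
    then obtain a' d' where d': "d' > 0" and le: "a' + k * d' \<le> N"
      and mono: "\<forall>j<k. c (a' + j * d') = c a'"
      using N unfolding vdw_bound_def by (metis image_subsetI lessThan_iff)
    have "(a + a' * d) + j * (d' * d) \<in> S (c a')" if "j < k" for j
    proof -
      have "j * d' \<le> k * d'"
        using that by simp
      then have "min (a' + j * d') N = a' + j * d'"
        using le by linarith
      then have "a + (a' + j * d') * d \<in> S (c a')"
        using c[of "a' + j * d'"] mono that by simp
      then show ?thesis
        by (simp add: add_mult_distrib mult.assoc add.assoc)
    qed
    moreover have "d' * d > 0"
      using d d' by simp
    ultimately show ?thesis
      using c unfolding contains_AP_def by blast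
  qed
  then show ?thesis
    by (intro exI[of _ "Suc N"]) auto
qed


section \<open>Digits of points of the circle\<close>

text \<open>The integer part of \<open>t\<close> changes \<open>2 ^ n * t\<close> by a multiple of
  \<open>2 ^ n\<close>, which is even for \<open>n \<ge> 1\<close>; digits can thus be read off any
  real representative.\<close>

lemma one_positions_frac: "one_positions (frac t) = {n. 1 \<le> n \<and> odd \<lfloor>2 ^ n * t\<rfloor>}"
proof -
  have "binary_digit (frac t) n = 1 \<longleftrightarrow> odd \<lfloor>2 ^ n * t\<rfloor>" if "1 \<le> n" for n
  proof -
    have "2 ^ n * frac t = 2 ^ n * t - of_int (2 ^ n * \<lfloor>t\<rfloor>)"
      by (simp add: frac_def algebra_simps)
    then have "\<lfloor>2 ^ n * frac t\<rfloor> = \<lfloor>2 ^ n * t\<rfloor> - 2 ^ n * \<lfloor>t\<rfloor>"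
      by (simp only: floor_diff_of_int)
    then have "odd \<lfloor>2 ^ n * frac t\<rfloor> \<longleftrightarrow> odd \<lfloor>2 ^ n * t\<rfloor>"
      using that by simp
    moreover have "binary_digit (frac t) n = nat (\<lfloor>2 ^ n * frac t\<rfloor> mod 2)"
      by (rule binary_digit_floor) (auto simp: frac_lt_1)
    ultimately show ?thesis
      by (auto simp: odd_iff_mod_2_eq_one)
  qed
  then show ?thesis
    unfolding one_positions_def by auto
qed

lemma one_positions_floor:
  assumes "x \<in> {0..<1}"
  shows "one_positions x = {n. 1 \<le> n \<and> odd \<lfloor>2 ^ n * x\<rfloor>}"
  using one_positions_frac[of x] assms frac_eq[of x] by simp

lemma one_positions_times2:
  assumes "x \<in> {0..<1}"
  shows "one_positions (times2 x) \<subseteq> {n. n + 1 \<in> one_positions x}"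
proof -
  have "2 ^ n * (2 * x) = 2 ^ (n + 1) * x" for n
    by simp
  then show ?thesis
    unfolding times2_def one_positions_frac one_positions_floor[OF assms]
    by (simp only: mem_Collect_eq) auto
qed

text \<open>For \<open>u = 2 ^ n * x\<close>, a digit \<open>0\<close> at position
  \<open>n + 1\<close> keeps the fractional part of \<open>u\<close> below \<open>1 / 2\<close>; two
  such parts add without carry.\<close>

lemma floor_double_even:
  fixes u :: real
  assumes "even \<lfloor>2 * u\<rfloor>"
  shows "u < of_int \<lfloor>u\<rfloor> + 1 / 2"
proof -
  obtain q where "\<lfloor>2 * u\<rfloor> = 2 * q"
    using assms by blast
  then have "of_int q \<le> u" and u: "u < of_int q + 1 / 2"
    by linarith+
  then have "\<lfloor>u\<rfloor> = q"
    by linarith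
  with u show ?thesis
    by simp
qed

text \<open>
  If \<open>x\<close> and \<open>y\<close> both have digits \<open>0\<close> at \<open>n\<close> and \<open>n + 1\<close>, no carry reaches position \<open>n\<close>.
\<close>

lemma one_positions_add:
  assumes x: "x \<in> {0..<1}" and y: "y \<in> {0..<1}"
    and n: "n \<in> one_positions (frac (x + y))"
  shows "n \<in> one_positions x \<or> n \<in> one_positions y \<or>
         n + 1 \<in> one_positions x \<or> n + 1 \<in> one_positions y"
proof (rule ccontr)
  define u where "u = 2 ^ n * x"
  define v where "v = 2 ^ n * y"
  assume *: "\<not> ?thesis"
  have "1 \<le> n" and odd: "odd \<lfloor>u + v\<rfloor>"
    using n by (auto simp: one_positions_frac u_def v_def distrib_left)
  then have even: "even \<lfloor>u\<rfloor>" "even \<lfloor>v\<rfloor>" "even \<lfloor>2 * u\<rfloor>" "even \<lfloor>2 * v\<rfloor>"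
    using * x y by (auto simp: one_positions_floor u_def v_def mult.assoc)
  have "u < of_int \<lfloor>u\<rfloor> + 1 / 2" "v < of_int \<lfloor>v\<rfloor> + 1 / 2"
    using even by (auto intro: floor_double_even)
  then have "\<lfloor>u + v\<rfloor> = \<lfloor>u\<rfloor> + \<lfloor>v\<rfloor>"
    by linarith
  with even odd show False
    by simp
qed


section \<open>The sets of points without \<open>k\<close>-term progressions\<close>

definition AP_free :: "nat \<Rightarrow> real set" where
  "AP_free k = {x \<in> {0..<1}. \<not> contains_AP (one_positions x) k}"

lemma AP_free_subset: "AP_free k \<subseteq> {0..<1}"
  unfolding AP_free_def by blast

lemma erdos_set_eq_Union: "erdos_set = (\<Union>k\<in>{1..}. AP_free k)"
  unfolding erdos_set_def erdosian_def AP_free_def UN_iff set_eq_iff mem_Collect_eq atLeast_iff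
  by blast

lemma times2_invariant_AP_free: "times2_invariant (AP_free k)"
proof -
  have "times2 x \<in> AP_free k" if x: "x \<in> AP_free k" for x
  proof -
    have "x \<in> {0..<1}" "\<not> contains_AP (one_positions x) k"
      using x by (auto simp: AP_free_def)
    then have "\<not> contains_AP (one_positions (times2 x)) k"
      using contains_AP_subset[OF _ one_positions_times2] contains_AP_shift by blast
    then show ?thesis
      by (simp add: AP_free_def times2_def frac_lt_1)
  qed
  then show ?thesis
    unfolding times2_invariant_def using AP_free_subset by blast
qed

text \<open>All ones of \<open>y\<close> lie beyond \<open>N\<close>, so a progression among them
  can be moved back by \<open>N\<close> into the ones of \<open>x\<close>.\<close>

lemma AP_free_subsequence:
  assumes x: "x \<in> AP_free k" and y: "y \<in> {0..<1}" and sub: "binary_subsequence y x"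
    and "1 \<le> k"
  shows "y \<in> AP_free k"
proof -
  obtain N where N: "\<And>i. 1 \<le> i \<Longrightarrow> binary_digit y (i + N) = 1 \<Longrightarrow> binary_digit x i = 1"
    and zero: "\<And>j. 1 \<le> j \<Longrightarrow> j \<le> N \<Longrightarrow> binary_digit y j = 0"
    using sub unfolding binary_subsequence_def by blast
  have pos: "n > N \<and> n - N \<in> one_positions x" if "n \<in> one_positions y" for n
    using that N[of "n - N"] zero[of n] unfolding one_positions_def
    by (cases "n \<le> N") auto
  have "\<not> contains_AP (one_positions y) k"
  proof
    assume "contains_AP (one_positions y) k"
    then obtain a d where "d > 0" and AP: "\<And>j. j < k \<Longrightarrow> a + j * d \<in> one_positions y"
      unfolding contains_AP_def by blast
    have "a > N"
      using pos[OF AP[of 0]] \<open>1 \<le> k\<close> by simp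
    then have "(a - N) + j * d \<in> one_positions x" if "j < k" for j
      using pos[OF AP[OF that]] by simp
    with \<open>d > 0\<close> x show False
      unfolding AP_free_def contains_AP_def by blast
  qed
  with y show ?thesis
    by (simp add: AP_free_def)
qed

lemma AP_free_add:
  "\<exists>L\<ge>1. circle_sumset (AP_free i) (AP_free j) \<subseteq> AP_free L"
proof -
  \<comment> \<open>The four sets will be the positions of \<open>1\<close> in \<open>x\<close> and
    in \<open>y\<close> and their shifts by one; length \<open>max i j\<close> contradicts either
    hypothesis.\<close>
  obtain L where "L \<ge> 1" and L: "\<And>S :: nat \<Rightarrow> nat set. contains_AP (\<Union>m<4. S m) L \<Longrightarrow>
      \<exists>m<4. contains_AP (S m) (max i j)"
    using contains_AP_finite_union by metis
  have "frac (x + y) \<in> AP_free L" if x: "x \<in> AP_free i" and y: "y \<in> AP_free j" for x y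
  proof (rule ccontr)
    define A where "A = one_positions x"
    define B where "B = one_positions y"
    define S where "S = (!) [A, B, {n. n + 1 \<in> A}, {n. n + 1 \<in> B}]"
    assume "frac (x + y) \<notin> AP_free L"
    then have "contains_AP (one_positions (frac (x + y))) L"
      by (simp add: AP_free_def frac_lt_1)
    moreover have "{..<4} = {0, 1, 2, 3 :: nat}"
      by auto
    then have "(\<Union>m<4. S m) = A \<union> B \<union> {n. n + 1 \<in> A} \<union> {n. n + 1 \<in> B}"
      by (simp add: S_def) blast
    then have "one_positions (frac (x + y)) \<subseteq> (\<Union>m<4. S m)"
      using one_positions_add[of x y] x y by (auto simp: A_def B_def AP_free_def)
    ultimately obtain m where "m < 4" "contains_AP (S m) (max i j)"
      using L contains_AP_subset by blast
    moreover from this have "m \<in> {0, 1, 2, 3}"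
      by auto
    ultimately have "contains_AP A (max i j) \<or> contains_AP B (max i j)"
      using contains_AP_shift[of 1] by (auto simp: S_def)
    then have "contains_AP A i \<or> contains_AP B j"
      using contains_AP_mono by (meson max.cobounded1 max.cobounded2)
    with x y show False
      by (auto simp: A_def B_def AP_free_def)
  qed
  with \<open>L \<ge> 1\<close> show ?thesis
    unfolding circle_sumset_def by blast
qed

section \<open>Closedness in the quotient topology\<close>

text \<open>For \<open>L < i \<le> L + k\<close>, \<open>2 ^ i * t\<close> is an even integer and
  \<open>2 ^ i * s\<close> lies below it by at most \<open>1\<close>, so the floor of the latter is
  odd.\<close>

lemma contains_AP_left_of_dyadic:
  assumes "2 ^ L * t = of_int q" "t - 1 / 2 ^ (L + k) \<le> s" "s < t"
  shows "contains_AP (one_positions (frac s)) k"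
proof -
  have "Suc L + j * 1 \<in> one_positions (frac s)" if "j < k" for j
  proof -
    define i where "i = Suc L + j"
    have i: "2 ^ i * t = of_int (2 ^ Suc j * q)"
      using assms(1) by (simp add: i_def power_add)
    have "2 ^ i * (t - 1 / 2 ^ (L + k)) \<le> 2 ^ i * s"
      using assms(2) by simp
    moreover have "(2 :: real) ^ i \<le> 2 ^ (L + k)"
      using that by (intro power_increasing) (auto simp: i_def)
    then have "2 ^ i * (1 / 2 ^ (L + k)) \<le> (1 :: real)"
      by simp
    moreover have "2 ^ i * s < 2 ^ i * t"
      using assms(3) by simp
    ultimately have "\<lfloor>2 ^ i * s\<rfloor> = 2 ^ Suc j * q - 1"
      unfolding i right_diff_distrib by linarith
    then show ?thesis
      by (simp add: one_positions_frac i_def)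
  qed
  then show ?thesis
    unfolding contains_AP_def by (intro exI[of _ "Suc L"] exI[of _ 1]) auto
qed

lemma closedin_AP_free: "closedin circle_top (AP_free k)"
proof -
  \<comment> \<open>Working with real \<open>t\<close> covers the class of \<open>0\<close>, whose
    left neighbours are the points near \<open>1\<close>.\<close>
  have "open {t. contains_AP (one_positions (frac t)) k}"
    unfolding open_dist Ball_def mem_Collect_eq
  proof (intro allI impI)
    fix t :: real
    assume "contains_AP (one_positions (frac t)) k"
    then obtain a d where d: "d > 0" and AP: "\<And>j. j < k \<Longrightarrow> a + j * d \<in> one_positions (frac t)"
      unfolding contains_AP_def by blast
    \<comment> \<open>\<open>L\<close> bounds all positions of the progression, so the floor of
      \<open>2 ^ L * s\<close> determines the digits of \<open>s\<close> there.\<close>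
    define L where "L = a + k * d"
    define q where "q = \<lfloor>2 ^ L * t\<rfloor>"
    have same: "contains_AP (one_positions (frac s)) k" if q: "\<lfloor>2 ^ L * s\<rfloor> = q" for s
    proof -
      have "\<lfloor>2 ^ n * s\<rfloor> = \<lfloor>2 ^ n * t\<rfloor>" if "n \<le> L" for n
      proof -
        have *: "\<lfloor>2 ^ n * r\<rfloor> = \<lfloor>2 ^ L * r\<rfloor> div 2 ^ (L - n)" for r :: real
        proof -
          have "2 ^ n * r = 2 ^ L * r / real (2 ^ (L - n))"
            using power_add[of "2 :: real" n "L - n"] that by simp
          then show ?thesis
            using floor_divide_real_eq_div[of "2 ^ (L - n)" "2 ^ L * r"] by simp
        qed
        show ?thesis
          unfolding * using q by (simp add: q_def)
      qed
      moreover have "a + j * d \<le> L" if "j < k" for j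
        using that by (simp add: L_def)
      ultimately have "a + j * d \<in> one_positions (frac s)" if "j < k" for j
        using AP[OF that] that by (simp add: one_positions_frac)
      with d show ?thesis
        unfolding contains_AP_def by blast
    qed
    have q_le: "of_int q \<le> 2 ^ L * t" and q_gt: "2 ^ L * t < of_int q + 1"
      unfolding q_def by linarith+
    show "\<exists>e>0. \<forall>s. dist s t < e \<longrightarrow> contains_AP (one_positions (frac s)) k"
    proof (cases "2 ^ L * t = of_int q")
      case True
      \<comment> \<open>That floor jumps at \<open>t\<close>: it is still \<open>q\<close> just to
        the right, while on the left a block of ones supplies another progression.\<close>
      have "contains_AP (one_positions (frac s)) k" if s: "dist s t < 1 / 2 ^ (L + k)" for s
      proof (cases "s < t")
        case True
        then show ?thesis
          using contains_AP_left_of_dyadic[OF \<open>2 ^ L * t = of_int q\<close>] s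
          by (simp add: dist_real_def)
      next
        case False
        have "1 / 2 ^ (L + k) \<le> 1 / (2 :: real) ^ L"
          by (intro divide_left_mono power_increasing) auto
        then have "s < t + 1 / 2 ^ L"
          using s by (simp add: dist_real_def)
        then have "2 ^ L * s < 2 ^ L * t + 1"
          by (simp add: field_simps)
        moreover have "2 ^ L * t \<le> 2 ^ L * s"
          using False by simp
        ultimately show ?thesis
          using True by (intro same) linarith
      qed
      then show ?thesis
        by (intro exI[of _ "1 / 2 ^ (L + k)"]) auto
    next
      case False
      have "open {s. of_int q < 2 ^ L * s \<and> 2 ^ L * s < of_int q + (1 :: real)}"
        by (intro open_Collect_conj open_Collect_less continuous_intros)
      moreover have "t \<in> {s. of_int q < 2 ^ L * s \<and> 2 ^ L * s < of_int q + (1 :: real)}"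
        using False q_le q_gt by simp
      ultimately obtain e where "e > 0"
        and e: "\<And>s. dist s t < e \<Longrightarrow> of_int q < 2 ^ L * s \<and> 2 ^ L * s < of_int q + (1 :: real)"
        unfolding open_dist by blast
      have "\<lfloor>2 ^ L * s\<rfloor> = q" if "dist s t < e" for s
        using e[OF that] by linarith
      with same \<open>e > 0\<close> show ?thesis
        by blast
    qed
  qed
  moreover have "frac -` ({0..<1} - AP_free k) = {t. contains_AP (one_positions (frac t)) k}"
    by (auto simp: AP_free_def frac_lt_1)
  ultimately show ?thesis
    by (auto simp: closedin_def openin_circle_top AP_free_def)
qed

theorem theorem4p1:
  shows "erdos_semigroup erdos_set"
proof -
  obtain W where "\<forall>i j. W i j \<ge> 1 \<and> circle_sumset (AP_free i) (AP_free j) \<subseteq> AP_free (W i j)"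
    using AP_free_add by metis
  then show ?thesis
    unfolding erdos_semigroup_def
    using erdos_set_eq_Union closedin_AP_free times2_invariant_AP_free AP_free_subsequence
    by (intro exI[of _ AP_free] conjI) blast+
qed

end
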